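(* Let $\ell\ge 1$ and let $G_1,\dots,G_\ell$ be finite graphs on the same vertex set $V$, where $G_i$ has $m_i$ edges. Then there is a bipartition of $V$ into two classes $A$ and $B$ such that for all $i=1,\dots,\ell$, $$e_{G_i}(A,B)\ge \frac{m_i}{2}-\sqrt{\ell m_i/2}.$$
   Context: Graphs are finite and simple. For disjoint subsets $A,B$ of the vertex set of a graph $G$, $e_G(A,B)$ denotes the number of edges of $G$ with one endvertex in $A$ and the other in $B$. A bipartition of $V$ means a pair of disjoint sets $A,B$ with $A\cup B=V$ (classes are allowed to be empty). *)

theory Defs
  imports Complex_Main
begin

text \<open>
  A finite simple graph with vertex set \<open>V\<close> is given by its set \<open>E\<close> of edges, an edge being
  a two-element subset of \<open>V\<close>. Its number of edges is thus \<open>card E\<close>.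
\<close>

definition finite_simple_graph :: "'a set \<Rightarrow> 'a set set \<Rightarrow> bool" where
  "finite_simple_graph V E \<longleftrightarrow> finite V \<and> (\<forall>e\<in>E. e \<subseteq> V \<and> card e = 2)"

text \<open>Intended for disjoint \<open>A\<close> and \<open>B\<close>.\<close>

definition edges_between :: "'a set set \<Rightarrow> 'a set \<Rightarrow> 'a set \<Rightarrow> nat" where
  "edges_between E A B = card {e \<in> E. \<exists>a\<in>A. \<exists>b\<in>B. e = {a, b}}"

text \<open>Either class may be empty.\<close>

definition bipartition :: "'a set \<Rightarrow> 'a set \<Rightarrow> 'a set \<Rightarrow> bool" where
  "bipartition V A B \<longleftrightarrow> A \<inter> B = {} \<and> A \<union> B = V"

end

theory Submission
  imports Defs
begin

text \<open>
  The second moment method. For a uniformly random class \<open>A \<subseteq> V\<close> the signs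
  \<open>\<chi>\<^sub>e = (-1)\<^bsup>\<bar>A \<inter> e\<bar>\<^esup>\<close> of distinct edges are uncorrelated, and \<open>\<chi>\<^sub>e = -1\<close> exactly when \<open>A\<close> cuts \<open>e\<close>.
  Hence \<open>S\<^sub>i = m\<^sub>i - 2 e(A, V - A)\<close>, the sum of the signs over \<open>G\<^sub>i\<close>, has second moment \<open>m\<^sub>i\<close>, and
  some \<open>A\<close> satisfies \<open>\<Sum>\<^sub>i S\<^sub>i\<^sup>2 / m\<^sub>i \<le> l\<close>, so that \<open>S\<^sub>i\<^sup>2 \<le> l m\<^sub>i\<close> for all \<open>i\<close>.
\<close>

definition cut_sign :: "'a set \<Rightarrow> 'a set \<Rightarrow> real" where
  "cut_sign A e = (- 1) ^ card (A \<inter> e)"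

lemma cut_sign_square: "cut_sign A e * cut_sign A e = 1"
  by (simp add: cut_sign_def flip: power_add mult_2)

lemma sum_Pow_insert:
  fixes g :: "'a set \<Rightarrow> 'b::comm_monoid_add"
  assumes "finite W" "v \<notin> W"
  shows "(\<Sum>A\<in>Pow (insert v W). g A) = (\<Sum>A\<in>Pow W. g A + g (insert v A))"
proof -
  have "inj_on (insert v) (Pow W)"
    using assms(2) by (auto simp: inj_on_def insert_eq_iff)
  moreover have "Pow W \<inter> insert v ` Pow W = {}"
    using assms(2) by auto
  ultimately show ?thesis
    using assms(1) by (simp add: Pow_insert sum.union_disjoint sum.reindex sum.distrib)
qed

text \<open>Toggling \<open>v\<close> pairs up the subsets of \<open>V\<close>. It flips the sign of
  \<open>e\<close>, which contains \<open>v\<close>, and keeps the sign of \<open>f\<close>, which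
  does not, so the two products in each pair cancel.\<close>

lemma sum_cut_sign_mult_eq_0:
  assumes "finite V" "e \<subseteq> V" "v \<in> e" "v \<notin> f"
  shows "(\<Sum>A\<in>Pow V. cut_sign A e * cut_sign A f) = 0"
proof -
  define W where "W = V - {v}"
  have V: "V = insert v W" "v \<notin> W" "finite W"
    using assms by (auto simp: W_def)
  have "cut_sign (insert v A) e * cut_sign (insert v A) f = - (cut_sign A e * cut_sign A f)"
    if "A \<in> Pow W" for A
  proof -
    have "finite A" "v \<notin> A"
      using that V finite_subset by auto
    then show ?thesis
      using assms(3,4) by (simp add: cut_sign_def)
  qed
  then show ?thesis
    unfolding V(1) sum_Pow_insert[OF V(3,2)] by (simp add: sum.neutral)
qed

lemma finite_simple_graph_finite_edges:
  assumes "finite_simple_graph V E"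
  shows "finite E"
proof (rule finite_subset)
  show "E \<subseteq> Pow V" "finite (Pow V)"
    using assms by (auto simp: finite_simple_graph_def)
qed

text \<open>Expanding the square leaves only the diagonal terms. The factor
  \<open>2 ^ card V\<close> counts the choices of \<open>A\<close>, as sums over
  \<open>Pow V\<close> replace expectations.\<close>

lemma sum_cut_sign_second_moment:
  assumes "finite_simple_graph V E"
  shows "(\<Sum>A\<in>Pow V. (\<Sum>e\<in>E. cut_sign A e)\<^sup>2) = 2 ^ card V * real (card E)"
proof -
  have V: "finite V" and E: "\<And>e. e \<in> E \<Longrightarrow> e \<subseteq> V \<and> card e = 2"
    using assms by (auto simp: finite_simple_graph_def)
  have orth: "(\<Sum>A\<in>Pow V. cut_sign A e * cut_sign A f) = (if f = e then 2 ^ card V else 0)"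
    if "e \<in> E" "f \<in> E" for e f
  proof (cases "f = e")
    case True
    then show ?thesis
      using V by (simp add: cut_sign_square card_Pow)
  next
    case False
    \<comment> \<open>Both edges have two vertices, so containment would force equality. A vertex of
      \<open>e\<close> outside \<open>f\<close> can then be toggled.\<close>
    then have "\<not> e \<subseteq> f"
      using that E V by (metis card_subset_eq finite_subset)
    then show ?thesis
      using sum_cut_sign_mult_eq_0[OF V] E that False by auto
  qed
  have "(\<Sum>A\<in>Pow V. (\<Sum>e\<in>E. cut_sign A e)\<^sup>2)
      = (\<Sum>A\<in>Pow V. \<Sum>e\<in>E. \<Sum>f\<in>E. cut_sign A e * cut_sign A f)"
    by (simp add: power2_eq_square sum_product)
  also have "\<dots> = (\<Sum>e\<in>E. \<Sum>A\<in>Pow V. \<Sum>f\<in>E. cut_sign A e * cut_sign A f)"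
    by (rule sum.swap)
  also have "\<dots> = (\<Sum>e\<in>E. \<Sum>f\<in>E. \<Sum>A\<in>Pow V. cut_sign A e * cut_sign A f)"
    by (intro sum.cong refl sum.swap)
  also have "\<dots> = (\<Sum>e\<in>E. \<Sum>f\<in>E. if f = e then 2 ^ card V else 0)"
    using orth by (intro sum.cong refl) auto
  also have "\<dots> = 2 ^ card V * real (card E)"
    using finite_simple_graph_finite_edges[OF assms] by simp
  finally show ?thesis .
qed

text \<open>An edge has 0, 1 or 2 endvertices in \<open>A\<close>, and it is cut exactly when this
  number is odd.\<close>

lemma cut_sign_edge:
  assumes "A \<subseteq> V" "e \<subseteq> V" "card e = 2"
  shows "cut_sign A e = (if \<exists>a\<in>A. \<exists>b\<in>V - A. e = {a, b} then - 1 else 1)"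
proof -
  obtain x y where e: "e = {x, y}" "x \<noteq> y"
    using assms(3) by (auto simp: card_2_iff)
  then show ?thesis
    using assms(1,2)
    by (cases "x \<in> A"; cases "y \<in> A") (auto simp: cut_sign_def Int_insert_right doubleton_eq_iff)
qed

lemma sum_cut_sign_eq:
  assumes "finite_simple_graph V E" "A \<subseteq> V"
  shows "(\<Sum>e\<in>E. cut_sign A e) = real (card E) - 2 * real (edges_between E A (V - A))"
proof -
  let ?P = "\<lambda>e. \<exists>a\<in>A. \<exists>b\<in>V - A. e = {a, b}"
  have fin: "finite E"
    by (rule finite_simple_graph_finite_edges[OF assms(1)])
  have "(\<Sum>e\<in>E. cut_sign A e) = (\<Sum>e\<in>E. 1 - 2 * (if ?P e then 1 else 0))"
    using assms by (intro sum.cong refl) (simp add: cut_sign_edge finite_simple_graph_def)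
  also have "\<dots> = real (card E) - 2 * (\<Sum>e\<in>E. if ?P e then 1 else 0)"
    by (simp add: sum_subtractf sum_distrib_left)
  also have "(\<Sum>e\<in>E. if ?P e then 1 else 0) = real (edges_between E A (V - A))"
    using fin by (simp add: edges_between_def flip: sum.inter_filter)
  finally show ?thesis .
qed

theorem theorem1:
  fixes V :: "'a set" and E :: "nat \<Rightarrow> 'a set set" and l :: nat
  assumes "l \<ge> 1"
    and "\<And>i. i \<in> {1..l} \<Longrightarrow> finite_simple_graph V (E i)"
  shows "\<exists>A B. bipartition V A B \<and>
    (\<forall>i\<in>{1..l}. real (edges_between (E i) A B)
        \<ge> real (card (E i)) / 2 - sqrt (real l * real (card (E i)) / 2))"
proof -
  have V: "finite V"
    using assms(1) assms(2)[of 1] by (simp add: finite_simple_graph_def)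
  let ?S = "\<lambda>A i. \<Sum>e\<in>E i. cut_sign A e"
  let ?D = "\<lambda>A. \<Sum>i\<in>{1..l}. (?S A i)\<^sup>2 / real (card (E i))"
  have "(\<Sum>A\<in>Pow V. ?D A) = (\<Sum>i\<in>{1..l}. (\<Sum>A\<in>Pow V. (?S A i)\<^sup>2) / real (card (E i)))"
    by (subst sum.swap) (simp add: sum_divide_distrib)
  \<comment> \<open>Equality holds for every nonempty \<open>E i\<close>; an edgeless graph
    contributes 0, since division by zero yields 0.\<close>
  also have "\<dots> \<le> (\<Sum>i\<in>{1..l}. 2 ^ card V)"
    using sum_cut_sign_second_moment[OF assms(2)] by (intro sum_mono) simp
  also have "\<dots> = (\<Sum>A\<in>Pow V. real l)"
    using V by (simp add: card_Pow)
  finally have avg: "(\<Sum>A\<in>Pow V. ?D A) \<le> (\<Sum>A\<in>Pow V. real l)" .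
  \<comment> \<open>Otherwise \<open>?D\<close> would exceed \<open>real l\<close> at every subset,
    and hence on average.\<close>
  have "\<exists>A\<in>Pow V. ?D A \<le> real l"
  proof (rule ccontr)
    assume "\<not> ?thesis"
    then have "(\<Sum>A\<in>Pow V. real l) < (\<Sum>A\<in>Pow V. ?D A)"
      using V by (intro sum_strict_mono) (auto simp: not_le)
    then show False
      using avg by linarith
  qed
  then obtain A where A: "A \<subseteq> V" "?D A \<le> real l"
    by blast
  have "real (edges_between (E i) A (V - A))
      \<ge> real (card (E i)) / 2 - sqrt (real l * real (card (E i)) / 2)"
    if i: "i \<in> {1..l}" for i
  proof -
    let ?m = "real (card (E i))"
    have "(?S A i)\<^sup>2 / ?m \<le> ?D A"
      using i by (intro member_le_sum) auto
    then have "(?S A i)\<^sup>2 / ?m \<le> real l"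
      using A(2) by linarith
    \<comment> \<open>If \<open>E i\<close> is empty, the quotient carries no information, but both
      sides are 0.\<close>
    then have "(?S A i)\<^sup>2 \<le> real l * ?m"
      using finite_simple_graph_finite_edges[OF assms(2)[OF i]]
      by (cases "E i = {}") (simp_all add: divide_le_eq card_gt_0_iff)
    \<comment> \<open>Halving \<open>?S A i\<close> divides its square by 4, so there is a factor of
      2 to spare here.\<close>
    then have "(?S A i / 2)\<^sup>2 \<le> real l * ?m / 2"
      using zero_le_power2[of "?S A i"] unfolding power_divide power2_eq_square[of 2] by linarith
    then have "?S A i / 2 \<le> sqrt (real l * ?m / 2)"
      by (rule real_le_rsqrt)
    then show ?thesis
      using sum_cut_sign_eq[OF assms(2)[OF i] A(1)] by simp
  qed
  moreover have "bipartition V A (V - A)"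
    using A(1) by (auto simp: bipartition_def)
  ultimately show ?thesis
    by blast
qed

end
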